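(* Let $f$ satisfy Assumption B (see context) with constants $L^-\ge L^+>1$, let $\underline\beta_*=\inf\mathcal S$ be as in the context, let $\beta_*\in(\underline\beta_*,1)$, $\beta^*\in(\beta_*,1)$, and let $(\alpha_n)$ be a (deterministic, possibly variable) sequence with $\alpha_n\in[\beta_*,\beta^*]$ for all $n$. Consider $$x_{n+1}=(1-\alpha_n)f(x_n)+\alpha_n x_n,\qquad n=0,1,2,\dots,\qquad x_0>0.$$ Then: (i) The solution with any $x_0>0$ converges to $K$. (ii) For any $x_0>0$ and $\delta>0$ there is a finite number of steps $S_1=S_1(x_0,\beta_*,\delta)$ such that $x_n\in(K-\delta,K+\delta)$ for $n\ge S_1$.
   Context: Assumption A on $f$: $f:[0,\infty)\to[0,\infty)$ is continuous, $f(0)=0$, $f$ has one positive equilibrium (fixed point) $K>0$, which is locally unstable for $x_{n+1}=f(x_n)$; $f(x)>x$ for $x\in(0,K)$ and $0<f(x)<x$ for $x\in(K,\infty)$. Notation: $f_m:=\max_{x\in[0,K]}f(x)$; $x_{\max}$ is the largest point of $[0,K]$ at which this maximum is attained; $f^2_m$ denotes the number $f^2_m:=\inf\{f(x):x\in(K,f_m)\}$ (not a square). One has $0<f^2_m<K<f_m$. Assumption B on $f$: Assumption A holds and for some constants $L^-\ge L^+>1$, $f(x)-K\le L^-(K-x)$ for $x\in(x_{\max},K)$ and $K-f(x)\le L^+(x-K)$ for $x\in(K,f_m)$. For $\beta\in[0,1)$, $x\ge0$: $G(\beta,x):=(1-\beta)f(x)+\beta x$, and $G^2(\beta,x):=G(\beta,G(\beta,x))$.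 Set $\mathcal S:=\{\beta\in(0,1): G^2(\beta,x)>x \text{ for all } x\in(f^2_m,K),\ G^2(\beta,x)<x\text{ for all }x\in(K,f_m)\}$ and $\underline\beta_*:=\inf\mathcal S$.
   Formalization: In (ii) the number of steps S_1 may depend on β^* (and on f) besides x_0, β_* and δ, and is uniform over all sequences (α_n) in [β_*, β^*]; independence of β^* would be false, since constant α_n near 1 moves arbitrarily slowly. *)

theory Defs
  imports Complex_Main
begin

text \<open>Maps \<open>[0,\<infinity>) \<rightarrow> [0,\<infinity>)\<close> are functions on \<open>real\<close>; only their values on \<open>{0..}\<close> are constrained
  or used.\<close>

text \<open>Lyapunov stability of an equilibrium \<open>K\<close> of \<open>x\<^sub>n\<^sub>+\<^sub>1 = f x\<^sub>n\<close> in the phase space \<open>[0,\<infinity>)\<close>.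
  Unstable means not stable in this sense.\<close>

definition locally_stable :: "(real \<Rightarrow> real) \<Rightarrow> real \<Rightarrow> bool" where
  "locally_stable f K \<longleftrightarrow>
     (\<forall>\<epsilon>>0. \<exists>\<delta>>0. \<forall>x\<ge>0. \<bar>x - K\<bar> < \<delta> \<longrightarrow> (\<forall>n. \<bar>(f ^^ n) x - K\<bar> < \<epsilon>))"

definition assumption_A :: "(real \<Rightarrow> real) \<Rightarrow> real \<Rightarrow> bool" where
  "assumption_A f K \<longleftrightarrow>
     (\<forall>x\<ge>0. f x \<ge> 0) \<and> continuous_on {0..} f \<and> f 0 = 0 \<and>
     K > 0 \<and> f K = K \<and> (\<forall>x>0. f x = x \<longrightarrow> x = K) \<and>
     \<not> locally_stable f K \<and>
     (\<forall>x. 0 < x \<and> x < K \<longrightarrow> f x > x) \<and>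
     (\<forall>x>K. 0 < f x \<and> f x < x)"

text \<open>Under \<open>assumption_A\<close> the supremum in \<open>f_max\<close> is attained and \<open>arg_f_max\<close> exists, by continuity
  on \<open>{0..K}\<close>; moreover \<open>K < f_max f K\<close> (by instability of \<open>K\<close>), so the infimum in \<open>f2_min\<close> is over
  a nonempty set bounded below by \<open>0\<close>.\<close>

definition f_max :: "(real \<Rightarrow> real) \<Rightarrow> real \<Rightarrow> real" where
  "f_max f K = (SUP x\<in>{0..K}. f x)"

definition arg_f_max :: "(real \<Rightarrow> real) \<Rightarrow> real \<Rightarrow> real" where
  "arg_f_max f K = (GREATEST x. x \<in> {0..K} \<and> f x = f_max f K)"

definition f2_min :: "(real \<Rightarrow> real) \<Rightarrow> real \<Rightarrow> real" where
  "f2_min f K = (INF x\<in>{K<..<f_max f K}. f x)"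

definition assumption_B :: "(real \<Rightarrow> real) \<Rightarrow> real \<Rightarrow> real \<Rightarrow> real \<Rightarrow> bool" where
  "assumption_B f K Lminus Lplus \<longleftrightarrow>
     assumption_A f K \<and> Lminus \<ge> Lplus \<and> Lplus > 1 \<and>
     (\<forall>x\<in>{arg_f_max f K<..<K}. f x - K \<le> Lminus * (K - x)) \<and>
     (\<forall>x\<in>{K<..<f_max f K}. K - f x \<le> Lplus * (x - K))"

definition G :: "(real \<Rightarrow> real) \<Rightarrow> real \<Rightarrow> real \<Rightarrow> real" where
  "G f \<beta> x = (1 - \<beta>) * f x + \<beta> * x"

definition stabilizing_set :: "(real \<Rightarrow> real) \<Rightarrow> real \<Rightarrow> real set" where
  "stabilizing_set f K = {\<beta>\<in>{0<..<1}.
     (\<forall>x\<in>{f2_min f K<..<K}. G f \<beta> (G f \<beta> x) > x) \<and>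
     (\<forall>x\<in>{K<..<f_max f K}. G f \<beta> (G f \<beta> x) < x)}"

text \<open>Under \<open>assumption_B\<close> the set is nonempty (it contains all \<open>\<beta> < 1\<close> close enough to \<open>1\<close>) and it is
  bounded below by \<open>0\<close>, so this is a genuine infimum.\<close>

definition beta_lower :: "(real \<Rightarrow> real) \<Rightarrow> real \<Rightarrow> real" where
  "beta_lower f K = Inf (stabilizing_set f K)"

primrec controlled_orbit :: "(real \<Rightarrow> real) \<Rightarrow> (nat \<Rightarrow> real) \<Rightarrow> real \<Rightarrow> nat \<Rightarrow> real" where
  "controlled_orbit f \<alpha> x0 0 = x0"
| "controlled_orbit f \<alpha> x0 (Suc n) =
     (1 - \<alpha> n) * f (controlled_orbit f \<alpha> x0 n) + \<alpha> n * controlled_orbit f \<alpha> x0 n"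

end

theory Submission
  imports Defs "HOL-Analysis.Analysis"
begin

text \<open>
  Write \<open>G\<^sub>\<beta>\<close> for the controlled map \<open>G f \<beta>\<close>. Since \<open>G\<^sub>\<beta> x\<close> is monotone in \<open>\<beta>\<close>, any control in
  \<open>[\<beta>lo, \<beta>hi]\<close> sends \<open>x\<close> to a point between \<open>l x\<close> and \<open>u x\<close>, the smaller and the larger of the
  values obtained with \<open>\<beta>lo\<close> and \<open>\<beta>hi\<close>. Starting from a compact interval that contains \<open>x0\<close>, lies in
  \<open>(0,\<infinity>)\<close> and is mapped into itself by \<open>f\<close>, these envelopes generate decreasing intervals
  that enclose all possible states after \<open>n\<close> steps. The intervals shrink to some \<open>[a, b]\<close>, and
  compactness provides \<open>s, t \<in> [a, b]\<close> with \<open>l s = a\<close> and \<open>u t = b\<close>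
  (\<open>nested_interval_attractor\<close>). They do not depend on the control sequence, so once
  \<open>a = b = K\<close> is known, convergence is uniform in the controls, and both claims follow.

  To see that \<open>a = b = K\<close>, note that below \<open>K\<close> every controlled map moves points up, and above \<open>K\<close> it
  moves them down. So the minimum \<open>a\<close> cannot be reached from below \<open>K\<close>, nor the
  maximum \<open>b\<close> from above: if the interval is not \<open>{K}\<close> then \<open>t < K < s\<close>. Choose \<open>\<gamma> < \<beta>lo\<close> in the
  stabilizing set. The stronger control gives a shorter move, so \<open>G\<^sub>\<gamma> t \<ge> b \<ge> s\<close> and \<open>G\<^sub>\<gamma> s \<le> a\<close>.
  By the intermediate value theorem \<open>s = G\<^sub>\<gamma> z\<close> for some \<open>z \<in> [t, K)\<close>, whence
  \<open>G\<^sub>\<gamma> (G\<^sub>\<gamma> z) \<le> a \<le> z\<close>, contrary to the choice of \<open>\<gamma>\<close>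
  (\<open>self_reproducing_interval_trivial\<close>).

  Such a \<open>\<gamma>\<close> exists only if the stabilizing set is nonempty, the infimum of the empty set of reals
  being an unspecified number. This is where the one-sided Lipschitz bounds and the instability
  of \<open>K\<close> enter (\<open>stabilizing_set_nonempty\<close>).
\<close>

section \<open>Orbits confined by two continuous envelopes\<close>

text \<open>
  The image of an interval under the set-valued map \<open>x \<mapsto> [l x, u x]\<close> has the hull
  \<open>[min l, max u]\<close>. Iterating this hull from \<open>[c, d]\<close> gives a decreasing sequence of compact
  intervals that traps all orbits simultaneously, which makes the bound \<open>N\<close> independent of the
  orbit. The limit \<open>[a, b]\<close> reproduces its own end points: these are limits of values of \<open>l\<close>
  and \<open>u\<close> at points of the approximating intervals, and such points accumulate in \<open>[a, b]\<close>.
\<close>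

lemma nested_interval_attractor:
  fixes l u :: "real \<Rightarrow> real"
  assumes cd: "c \<le> d"
    and contl: "continuous_on {c..d} l" and contu: "continuous_on {c..d} u"
    and inv: "\<And>x. x \<in> {c..d} \<Longrightarrow> c \<le> l x \<and> l x \<le> u x \<and> u x \<le> d"
  obtains a b s t where
    "c \<le> a" "b \<le> d" "s \<in> {a..b}" "t \<in> {a..b}" "l s = a" "u t = b"
    "\<forall>\<epsilon>>0. \<exists>N. \<forall>x. x 0 \<in> {c..d} \<longrightarrow> (\<forall>n. x (Suc n) \<in> {l (x n)..u (x n)}) \<longrightarrow>
       (\<forall>n\<ge>N. x n \<in> {a - \<epsilon><..<b + \<epsilon>})"
proof -
  define I where "I = rec_nat (c, d) (\<lambda>_ (p, q). (Inf (l ` {p..q}), Sup (u ` {p..q})))"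
  define A where "A n = fst (I n)" for n
  define B where "B n = snd (I n)" for n
  have A0: "A 0 = c" and B0: "B 0 = d" by (auto simp: A_def B_def I_def)
  have AS: "A (Suc n) = Inf (l ` {A n..B n})" and BS: "B (Suc n) = Sup (u ` {A n..B n})" for n
    by (auto simp: A_def B_def I_def split: prod.splits)
  have minl: "\<exists>s\<in>{p..q}. Inf (l ` {p..q}) = l s \<and> (\<forall>x\<in>{p..q}. l s \<le> l x)"
    if pq: "c \<le> p" "p \<le> q" "q \<le> d" for p q
  proof -
    have "continuous_on {p..q} l" using contl by (rule continuous_on_subset) (use pq in auto)
    then obtain s where "s \<in> {p..q}" "\<forall>x\<in>{p..q}. l s \<le> l x"
      using continuous_attains_inf[of "{p..q}" l] pq by auto
    then show ?thesis by (intro bexI[of _ s] conjI cInf_eq_minimum) auto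
  qed
  have maxu: "\<exists>t\<in>{p..q}. Sup (u ` {p..q}) = u t \<and> (\<forall>x\<in>{p..q}. u x \<le> u t)"
    if pq: "c \<le> p" "p \<le> q" "q \<le> d" for p q
  proof -
    have "continuous_on {p..q} u" using contu by (rule continuous_on_subset) (use pq in auto)
    then obtain t where "t \<in> {p..q}" "\<forall>x\<in>{p..q}. u x \<le> u t"
      using continuous_attains_sup[of "{p..q}" u] pq by auto
    then show ?thesis by (intro bexI[of _ t] conjI cSup_eq_maximum) auto
  qed
  have nest: "c \<le> A n \<and> A n \<le> B n \<and> B n \<le> d \<and> A n \<le> A (Suc n) \<and> B (Suc n) \<le> B n" for n
  proof (induction n)
    case 0
    obtain s t where s: "s \<in> {c..d}" "A (Suc 0) = l s" and t: "t \<in> {c..d}" "B (Suc 0) = u t"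
      using minl[of c d] maxu[of c d] cd AS[of 0] BS[of 0] A0 B0 by auto
    with inv[of s] inv[of t] cd show ?case by (simp add: A0 B0)
  next
    case (Suc n)
    obtain s where s: "s \<in> {A n..B n}" "A (Suc n) = l s" "\<forall>x\<in>{A n..B n}. l s \<le> l x"
      using minl[of "A n" "B n"] Suc AS[of n] by auto
    obtain t where t: "t \<in> {A n..B n}" "B (Suc n) = u t" "\<forall>x\<in>{A n..B n}. u x \<le> u t"
      using maxu[of "A n" "B n"] Suc BS[of n] by auto
    have "l s \<le> l t" "l t \<le> u t" using s t inv[of t] Suc by auto
    then have ord: "c \<le> A (Suc n)" "A (Suc n) \<le> B (Suc n)" "B (Suc n) \<le> d"
      using s(2) t(2) Suc by auto
    obtain s' where s': "s' \<in> {A (Suc n)..B (Suc n)}" "A (Suc (Suc n)) = l s'"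
      using minl[OF ord] AS[of "Suc n"] by auto
    obtain t' where t': "t' \<in> {A (Suc n)..B (Suc n)}" "B (Suc (Suc n)) = u t'"
      using maxu[OF ord] BS[of "Suc n"] by auto
    have "A (Suc n) \<le> A (Suc (Suc n))" "B (Suc (Suc n)) \<le> B (Suc n)"
      using s s' t t' Suc by auto
    with ord show ?case by simp
  qed
  have "\<forall>n. \<exists>s. s \<in> {A n..B n} \<and> l s = A (Suc n)"
  proof
    fix n
    show "\<exists>s. s \<in> {A n..B n} \<and> l s = A (Suc n)"
      using minl[of "A n" "B n"] nest[of n] AS[of n] by auto
  qed
  then obtain S where S: "\<And>n. S n \<in> {A n..B n}" "\<And>n. l (S n) = A (Suc n)" by metis
  have "\<forall>n. \<exists>t. t \<in> {A n..B n} \<and> u t = B (Suc n)"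
  proof
    fix n
    show "\<exists>t. t \<in> {A n..B n} \<and> u t = B (Suc n)"
      using maxu[of "A n" "B n"] nest[of n] BS[of n] by auto
  qed
  then obtain T where T: "\<And>n. T n \<in> {A n..B n}" "\<And>n. u (T n) = B (Suc n)" by metis
  have incA: "incseq A" using nest by (intro incseq_SucI) auto
  have decB: "decseq B" using nest by (intro decseq_SucI) auto
  have "A n \<le> d" "c \<le> B n" for n using nest[of n] by auto
  then obtain a b where a: "A \<longlonglongrightarrow> a" "\<And>n. A n \<le> a" and b: "B \<longlonglongrightarrow> b" "\<And>n. b \<le> B n"
    using incseq_convergent[OF incA, of d] decseq_convergent[OF decB, of c] by metis
  (* used twice: for h = l with the minimisers S n, and for h = u with the maximisers T n *)
  have limit: "\<exists>z\<in>{a..b}. h z = w"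
    if h: "continuous_on {c..d} h" and Z: "\<And>n. Z n \<in> {A n..B n}"
      and hZ: "(\<lambda>n. h (Z n)) \<longlonglongrightarrow> w" for h Z and w :: real
  proof -
    have Zcd: "\<forall>n. Z n \<in> {c..d}" using Z nest by (meson atLeastAtMost_iff order_trans)
    then obtain z r where z: "z \<in> {c..d}" and r: "strict_mono (r :: nat \<Rightarrow> nat)"
      and lim: "(Z \<circ> r) \<longlonglongrightarrow> z"
      using compact_Icc[of c d] unfolding compact_def by meson
    have "(\<lambda>n. h ((Z \<circ> r) n)) \<longlonglongrightarrow> h z"
      using continuous_on_tendsto_compose[OF h lim z] Zcd by simp
    moreover have "(\<lambda>n. h ((Z \<circ> r) n)) \<longlonglongrightarrow> w"
      using LIMSEQ_subseq_LIMSEQ[OF hZ r] by (simp add: o_def)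
    ultimately have "h z = w" by (rule LIMSEQ_unique)
    moreover have "a \<le> z"
      by (rule LIMSEQ_le[OF LIMSEQ_subseq_LIMSEQ[OF a(1) r] lim]) (use Z in auto)
    moreover have "z \<le> b"
      by (rule LIMSEQ_le[OF lim LIMSEQ_subseq_LIMSEQ[OF b(1) r]]) (use Z in auto)
    ultimately show ?thesis by auto
  qed
  have "(\<lambda>n. l (S n)) \<longlonglongrightarrow> a" using LIMSEQ_Suc[OF a(1)] S(2) by simp
  from limit[OF contl S(1) this] obtain s where s: "s \<in> {a..b}" "l s = a" by auto
  have "(\<lambda>n. u (T n)) \<longlonglongrightarrow> b" using LIMSEQ_Suc[OF b(1)] T(2) by simp
  from limit[OF contu T(1) this] obtain t where t: "t \<in> {a..b}" "u t = b" by auto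
  have attract: "\<exists>N. \<forall>x. x 0 \<in> {c..d} \<longrightarrow> (\<forall>n. x (Suc n) \<in> {l (x n)..u (x n)}) \<longrightarrow>
       (\<forall>n\<ge>N. x n \<in> {a - \<epsilon><..<b + \<epsilon>})" if eps: "0 < \<epsilon>" for \<epsilon>
  proof -
    have "eventually (\<lambda>n. a - \<epsilon> < A n) sequentially" "eventually (\<lambda>n. B n < b + \<epsilon>) sequentially"
      using order_tendstoD(1)[OF a(1), of "a - \<epsilon>"] order_tendstoD(2)[OF b(1), of "b + \<epsilon>"] eps by auto
    then have "eventually (\<lambda>n. a - \<epsilon> < A n \<and> B n < b + \<epsilon>) sequentially"
      by (rule eventually_conj)
    then obtain N where N: "\<And>n. n \<ge> N \<Longrightarrow> a - \<epsilon> < A n \<and> B n < b + \<epsilon>"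
      unfolding eventually_sequentially by auto
    have "x n \<in> {A n..B n}" if x: "x 0 \<in> {c..d}" "\<forall>n. x (Suc n) \<in> {l (x n)..u (x n)}" for x n
    proof (induction n)
      case 0
      then show ?case using x A0 B0 by simp
    next
      case (Suc n)
      have "A (Suc n) \<le> l (x n)" "u (x n) \<le> B (Suc n)"
        using Suc minl[of "A n" "B n"] maxu[of "A n" "B n"] nest[of n] AS[of n] BS[of n] by auto
      then show ?case using x(2) by (meson atLeastAtMost_iff order_trans)
    qed
    then have "\<forall>x. x 0 \<in> {c..d} \<longrightarrow> (\<forall>n. x (Suc n) \<in> {l (x n)..u (x n)}) \<longrightarrow>
       (\<forall>n\<ge>N. x n \<in> {a - \<epsilon><..<b + \<epsilon>})"
      using N by (meson atLeastAtMost_iff greaterThanLessThan_iff le_less_trans less_le_trans)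
    then show ?thesis ..
  qed
  have "c \<le> a" "b \<le> d" using a(2)[of 0] b(2)[of 0] A0 B0 by auto
  then show thesis using that s t attract by blast
qed

section \<open>The uncontrolled map\<close>

lemma
  assumes A: "assumption_A f K"
  shows K_pos: "0 < K" and f_at_K: "f K = K"
    and f_nonneg: "0 \<le> x \<Longrightarrow> 0 \<le> f x"
    and f_above: "0 < x \<Longrightarrow> x < K \<Longrightarrow> x < f x"
    and f_below: "K < x \<Longrightarrow> f x < x"
    and f_pos: "0 < x \<Longrightarrow> 0 < f x"
    and f_continuous: "continuous_on {0..} f"
proof -
  note A' = A[unfolded assumption_A_def]
  show "0 < K" "f K = K" "0 \<le> x \<Longrightarrow> 0 \<le> f x" "0 < x \<Longrightarrow> x < K \<Longrightarrow> x < f x"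
    "K < x \<Longrightarrow> f x < x" "continuous_on {0..} f"
    using A' by auto
  show "0 < f x" if x: "0 < x"
  proof (cases x K rule: linorder_cases)
    case less
    then have "x < f x" using A' x by blast
    with x show ?thesis by simp
  next
    case equal
    moreover have "f K = K" using A' by blast
    ultimately show ?thesis using x by simp
  next
    case greater
    then show ?thesis using A' by blast
  qed
qed

lemma f_max_attained:
  assumes "assumption_A f K"
  obtains p where "p \<in> {0..K}" "f p = f_max f K" "\<And>x. x \<in> {0..K} \<Longrightarrow> f x \<le> f_max f K"
proof -
  have "continuous_on {0..K} f"
    using f_continuous[OF assms] by (rule continuous_on_subset) auto
  then obtain p where p: "p \<in> {0..K}" "\<forall>x\<in>{0..K}. f x \<le> f p"
    using continuous_attains_sup[of "{0..K}" f] K_pos[OF assms] by auto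
  then have eq: "f_max f K = f p" unfolding f_max_def by (intro cSup_eq_maximum) auto
  show thesis by (rule that[of p]) (use p in \<open>simp_all add: eq\<close>)
qed

lemma f_le_f_max:
  assumes "assumption_A f K" "x \<in> {0..K}"
  shows "f x \<le> f_max f K"
  by (rule f_max_attained[OF assms(1)]) (use assms(2) in blast)

text \<open>
  Otherwise \<open>f\<close> never overshoots \<open>K\<close> from the left. An orbit starting near \<open>K\<close> then decreases
  while it is above \<open>K\<close>, lands close to \<open>K\<close> by continuity if it ever passes \<open>K\<close>, and increases
  without passing \<open>K\<close> again afterwards, so \<open>K\<close> would be stable.
\<close>

lemma K_less_f_max:
  assumes A: "assumption_A f K"
  shows "K < f_max f K"
proof (rule ccontr)
  assume "\<not> K < f_max f K"
  then have le: "f x \<le> K" if "x \<in> {0..K}" for x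
    using f_le_f_max[OF A that] by simp
  have "locally_stable f K"
    unfolding locally_stable_def
  proof (intro allI impI)
    fix \<epsilon> :: real
    assume eps: "\<epsilon> > 0"
    (* capping by K keeps the points of (K - e, K) positive, where f x > x is available *)
    define e where "e = min \<epsilon> K"
    have e: "0 < e" "e \<le> \<epsilon>" "e \<le> K" using eps K_pos[OF A] by (auto simp: e_def)
    have "\<exists>d>0. \<forall>x\<in>{0..}. dist x K < d \<longrightarrow> dist (f x) (f K) < e"
      using f_continuous[OF A] e K_pos[OF A] unfolding continuous_on_iff by auto
    then obtain d0 where d0: "d0 > 0" "\<And>x. x \<ge> 0 \<Longrightarrow> \<bar>x - K\<bar> < d0 \<Longrightarrow> \<bar>f x - K\<bar> < e"
      by (auto simp: dist_real_def f_at_K[OF A])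
    define d where "d = min d0 e"
    have d: "0 < d" "d \<le> e" "\<And>x. x \<ge> 0 \<Longrightarrow> \<bar>x - K\<bar> < d \<Longrightarrow> \<bar>f x - K\<bar> < e"
      using d0 e by (auto simp: d_def)
    show "\<exists>\<delta>>0. \<forall>x\<ge>0. \<bar>x - K\<bar> < \<delta> \<longrightarrow> (\<forall>n. \<bar>(f ^^ n) x - K\<bar> < \<epsilon>)"
    proof (intro exI[of _ d] conjI allI impI)
      fix x n
      assume x: "0 \<le> x" "\<bar>x - K\<bar> < d"
      (* asymmetric, as only points above K rely on continuity for the next step *)
      have "K - e < (f ^^ n) x \<and> (f ^^ n) x < K + d"
      proof (induction n)
        case 0
        then show ?case using x d by auto
      next
        case (Suc n)
        let ?y = "(f ^^ n) x"
        have pos: "0 < ?y" using Suc e by linarith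
        show ?case
        proof (cases ?y K rule: linorder_cases)
          case less
          then show ?thesis using f_above[OF A pos less] le[of ?y] pos Suc d by auto
        next
          case equal
          then show ?thesis using f_at_K[OF A] e d by simp
        next
          case greater
          then show ?thesis using f_below[OF A greater] d(3)[of ?y] pos Suc by auto
        qed
      qed
      then show "\<bar>(f ^^ n) x - K\<bar> < \<epsilon>" using e d by auto
    qed (rule d(1))
  qed
  with A show False by (simp add: assumption_A_def)
qed

lemma arg_f_max_bounds:
  assumes A: "assumption_A f K"
  shows "0 \<le> arg_f_max f K" "arg_f_max f K < K"
proof -
  let ?P = "\<lambda>x. x \<in> {0..K} \<and> f x = f_max f K"
  have cont: "continuous_on {0..K} f"
    using f_continuous[OF A] by (rule continuous_on_subset) auto
  have "closed {x. ?P x}"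
    using continuous_closed_preimage_constant[OF cont closed_atLeastAtMost] by simp
  then have "compact ({0..K} \<inter> {x. ?P x})"
    by (rule compact_Int_closed[OF compact_Icc])
  moreover have "{0..K} \<inter> {x. ?P x} = {x. ?P x}" by auto
  ultimately have cpt: "compact {x. ?P x}" by simp
  have "{x. ?P x} \<noteq> {}"
    by (rule f_max_attained[OF A]) auto
  with compact_attains_sup[OF cpt] obtain p where p: "?P p" "\<And>x. ?P x \<Longrightarrow> x \<le> p"
    by auto
  then have "arg_f_max f K = p" unfolding arg_f_max_def by (intro Greatest_equality) auto
  moreover have "p \<noteq> K" using p(1) K_less_f_max[OF A] f_at_K[OF A] by auto
  ultimately show "0 \<le> arg_f_max f K" "arg_f_max f K < K" using p(1) by auto
qed

lemma f2_min_le: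
  assumes A: "assumption_A f K" and "x \<in> {K<..<f_max f K}"
  shows "f2_min f K \<le> f x"
  unfolding f2_min_def
proof (rule cINF_lower)
  show "bdd_below (f ` {K<..<f_max f K})"
    using f_nonneg[OF A] K_pos[OF A] by (intro bdd_belowI2[of _ 0]) auto
qed (fact assms(2))

lemma f2_min_nonneg:
  assumes A: "assumption_A f K"
  shows "0 \<le> f2_min f K"
  unfolding f2_min_def
  using K_less_f_max[OF A] f_nonneg[OF A] K_pos[OF A] by (intro cINF_greatest) auto

section \<open>The controlled maps\<close>

lemma G_alt: "G f \<beta> x = x + (1 - \<beta>) * (f x - x)"
  by (simp add: G_def algebra_simps)

lemma G_fixed: "f K = K \<Longrightarrow> G f \<beta> K = K"
  by (simp add: G_alt)

lemma G_above:
  assumes "x < f x" "\<beta> < 1"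
  shows "x < G f \<beta> x"
  using assms by (simp add: G_alt)

lemma G_below:
  assumes "f x < x" "\<beta> < 1"
  shows "G f \<beta> x < x"
  using assms by (simp add: G_alt mult_pos_neg)

lemma G_antimono:
  assumes "x \<le> f x" "\<alpha> \<le> \<beta>"
  shows "G f \<beta> x \<le> G f \<alpha> x"
  using assms by (simp add: G_alt mult_right_mono)

lemma G_mono:
  assumes "f x \<le> x" "\<alpha> \<le> \<beta>"
  shows "G f \<alpha> x \<le> G f \<beta> x"
  using assms by (simp add: G_alt mult_right_mono_neg)

lemma continuous_on_G:
  "continuous_on S f \<Longrightarrow> continuous_on S (G f \<beta>)"
  unfolding G_def by (intro continuous_intros)

text \<open>
  A control \<open>\<beta>\<close> close to 1 shrinks each step so much that no state below \<open>f_max f K\<close> crosses \<open>K\<close>.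
  The orbit of such a state under constant control is then monotone, so \<open>\<beta>\<close> stabilizes. Right of the
  last maximum point \<open>p\<close> of \<open>f\<close> on \<open>[0, K]\<close> the Lipschitz bounds prevent crossing as soon as
  \<open>(1 - \<beta>) L \<le> \<beta>\<close> for the larger constant \<open>L\<close>. Left of \<open>p\<close> there is no such bound, but there \<open>G f \<beta> x \<le> (1 - \<beta>) * f_max f K + \<beta> * p\<close>,
  which is at most \<open>K\<close> for large \<open>\<beta>\<close> because \<open>p < K\<close>.
\<close>

lemma stabilizing_set_nonempty:
  assumes B: "assumption_B f K Lminus Lplus"
  shows "stabilizing_set f K \<noteq> {}"
proof -
  have A: "assumption_A f K" and L: "1 < Lplus" "Lplus \<le> Lminus"
    and left: "\<And>x. arg_f_max f K < x \<Longrightarrow> x < K \<Longrightarrow> f x - K \<le> Lminus * (K - x)"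
    and right: "\<And>x. K < x \<Longrightarrow> x < f_max f K \<Longrightarrow> K - f x \<le> Lplus * (x - K)"
    using B by (auto simp: assumption_B_def)
  let ?M = "f_max f K" and ?p = "arg_f_max f K"
  note M = K_less_f_max[OF A] and p = arg_f_max_bounds[OF A] and K = K_pos[OF A] f_at_K[OF A]
  (* the least value that meets both requirements (1 - \<beta>) L \<le> \<beta> and (1 - \<beta>) ?M + \<beta> ?p \<le> K *)
  define \<beta> where "\<beta> = max (Lminus / (1 + Lminus)) ((?M - K) / (?M - ?p))"
  have b01: "0 < \<beta>" "\<beta> < 1" using L M p by (auto simp: \<beta>_def less_max_iff_disj)
  have "Lminus / (1 + Lminus) \<le> \<beta>" by (simp add: \<beta>_def)
  then have bL: "(1 - \<beta>) * Lminus \<le> \<beta>" using L by (simp add: field_simps)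
  have "(?M - K) / (?M - ?p) \<le> \<beta>" by (simp add: \<beta>_def)
  then have bM: "(1 - \<beta>) * ?M + \<beta> * ?p \<le> K" using M p by (simp add: field_simps)
  have G_le: "G f \<beta> x \<le> K" if x: "0 < x" "x < K" for x
  proof (cases "x \<le> ?p")
    case True
    have "(1 - \<beta>) * f x + \<beta> * x \<le> (1 - \<beta>) * ?M + \<beta> * ?p"
      using f_le_f_max[OF A, of x] x True b01 by (intro add_mono mult_left_mono) auto
    with bM show ?thesis by (simp add: G_def)
  next
    case False
    have "(1 - \<beta>) * (f x - K) \<le> (1 - \<beta>) * (Lminus * (K - x))"
      using left[of x] False x b01 by (intro mult_left_mono) auto
    also have "\<dots> \<le> \<beta> * (K - x)"
      using mult_right_mono[OF bL, of "K - x"] x by (simp add: mult.assoc)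
    finally show ?thesis by (simp add: G_def algebra_simps)
  qed
  have G_ge: "K \<le> G f \<beta> x" if x: "K < x" "x < ?M" for x
  proof -
    have "(1 - \<beta>) * (K - f x) \<le> (1 - \<beta>) * (Lplus * (x - K))"
      using right[of x] x b01 by (intro mult_left_mono) auto
    also have "\<dots> \<le> (1 - \<beta>) * (Lminus * (x - K))"
      using x b01 L by (intro mult_left_mono mult_right_mono) auto
    also have "\<dots> \<le> \<beta> * (x - K)"
      using mult_right_mono[OF bL, of "x - K"] x by (simp add: mult.assoc)
    finally show ?thesis by (simp add: G_def algebra_simps)
  qed
  have "x < G f \<beta> (G f \<beta> x)" if x: "f2_min f K < x" "x < K" for x
  proof -
    have x0: "0 < x" using f2_min_nonneg[OF A] x by linarith
    have "x < G f \<beta> x" using G_above[where f = f, OF f_above[OF A x0 x(2)] b01(2)] .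
    also have "G f \<beta> x \<le> G f \<beta> (G f \<beta> x)"
    proof (cases "G f \<beta> x = K")
      case False
      then have "G f \<beta> x < K" using G_le[OF x0 x(2)] by simp
      then show ?thesis using \<open>x < G f \<beta> x\<close> x0 G_above[where f = f, OF f_above[OF A] b01(2), of "G f \<beta> x"] by simp
    qed (simp add: G_fixed[where f = f, OF K(2)])
    finally show ?thesis .
  qed
  moreover have "G f \<beta> (G f \<beta> x) < x" if x: "K < x" "x < ?M" for x
  proof -
    have "G f \<beta> (G f \<beta> x) \<le> G f \<beta> x"
    proof (cases "G f \<beta> x = K")
      case False
      then have "K < G f \<beta> x" using G_ge[OF x] by simp
      then show ?thesis using G_below[where f = f, OF f_below[OF A] b01(2), of "G f \<beta> x"] by simp
    qed (simp add: G_fixed[where f = f, OF K(2)])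
    also have "\<dots> < x" using G_below[where f = f, OF f_below[OF A x(1)] b01(2)] .
    finally show ?thesis .
  qed
  ultimately have "\<beta> \<in> stabilizing_set f K" using b01 by (auto simp: stabilizing_set_def)
  then show ?thesis by auto
qed

section \<open>Convergence\<close>

text \<open>
  Minimality of \<open>a\<close> forces \<open>s \<ge> K\<close>, maximality of \<open>b\<close> forces \<open>t \<le> K\<close>, and if one of
  \<open>s\<close> and \<open>t\<close> is the fixed point \<open>K\<close>, then so is its image, an end point of the interval, which
  squeezes the other one to \<open>K\<close> as well. The case \<open>t < K < s\<close> is
  excluded by comparing one step under \<open>\<sigma>\<close> and \<open>\<tau>\<close> with one step under the smaller control \<open>\<gamma>\<close>,
  which goes at least as far.
\<close>

lemma self_reproducing_interval_trivial:
  assumes A: "assumption_A f K" and \<gamma>: "\<gamma> \<in> stabilizing_set f K"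
    and \<sigma>: "\<sigma> \<in> {\<gamma>..<1}" and \<tau>: "\<tau> \<in> {\<gamma>..<1}"
    and a: "0 < a" and s: "s \<in> {a..b}" "G f \<sigma> s = a" and t: "t \<in> {a..b}" "G f \<tau> t = b"
  shows "a = K" "b = K"
proof -
  note K = K_pos[OF A] f_at_K[OF A]
  have \<gamma>01: "0 < \<gamma>" "\<gamma> < 1" using \<gamma> by (auto simp: stabilizing_set_def)
  have pos: "0 < s" "0 < t" using a s t by auto
  have s_cases: "s = K \<or> K < s" 
    using G_above[where f = f, OF f_above[OF A pos(1)], of \<sigma>] \<sigma> s by (cases s K rule: linorder_cases) auto
  have t_cases: "t = K \<or> t < K"
    using G_below[where f = f, OF f_below[OF A], of t \<tau>] \<tau> t by (cases t K rule: linorder_cases) auto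
  have "\<not> (t < K \<and> K < s)"
  proof
    assume ts: "t < K \<and> K < s"
    let ?M = "f_max f K"
    (* the stabilizing condition holds only on the open interval from f2_min f K to K,
       so z below has to be placed there: b < ?M yields f2_min f K < a \<le> z *)
    have "b = (1 - \<tau>) * f t + \<tau> * t" using t by (simp add: G_def)
    also have "\<dots> < (1 - \<tau>) * ?M + \<tau> * ?M"
      using f_le_f_max[OF A, of t] pos ts K_less_f_max[OF A] \<tau> \<gamma>01
      by (intro add_le_less_mono mult_left_mono mult_strict_left_mono) auto
    finally have "b < ?M" by (simp add: algebra_simps)
    then have "f2_min f K \<le> f s" using s ts by (intro f2_min_le[OF A]) auto
    moreover have "0 < \<sigma> * (s - f s)" using f_below[OF A, of s] ts \<sigma> \<gamma>01 by simp
    ultimately have "f2_min f K < a" using s by (simp add: G_def algebra_simps)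
    have "s \<le> G f \<gamma> t"
      using G_antimono[of t f \<gamma> \<tau>] f_above[OF A pos(2)] ts \<tau> s t by auto
    moreover have "continuous_on {t..K} (G f \<gamma>)"
      using continuous_on_subset[OF f_continuous[OF A], of "{t..K}"] pos
      by (intro continuous_on_G) auto
    ultimately obtain z where z: "t \<le> z" "z \<le> K" "G f \<gamma> z = s"
      using IVT2'[of "G f \<gamma>" K s t] G_fixed[where f = f, OF K(2), of \<gamma>] ts by auto
    have "z \<noteq> K" using z ts G_fixed[where f = f, OF K(2), of \<gamma>] by auto
    then have "z < G f \<gamma> (G f \<gamma> z)"
      using \<gamma> z t \<open>f2_min f K < a\<close> by (auto simp: stabilizing_set_def)
    also have "\<dots> = G f \<gamma> s" using z by simp
    also have "\<dots> \<le> a" using G_mono[of f s \<gamma> \<sigma>] f_below[OF A, of s] ts \<sigma> s by auto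
    finally show False using z t by auto
  qed
  moreover have "a = K" if "s = K" using that s G_fixed[where f = f, OF K(2)] by simp
  moreover have "b = K" if "t = K" using that t G_fixed[where f = f, OF K(2)] by simp
  ultimately show "a = K" "b = K" using s_cases t_cases s t by auto
qed

text \<open>
  An upward step starts below \<open>K\<close> and reaches at most \<open>f_max f K\<close>; a downward step starts
  above \<open>K\<close> and reaches at least the minimum of \<open>f\<close> on \<open>[K, d]\<close>. That minimum
  is positive, which keeps the interval away from the fixed point 0.
\<close>

lemma invariant_interval:
  assumes A: "assumption_A f K" and x0: "0 < x0"
  obtains c d where "0 < c" "x0 \<in> {c..d}" "\<And>x. x \<in> {c..d} \<Longrightarrow> f x \<in> {c..d}"
proof -
  define d where "d = max x0 (f_max f K)"
  have d: "K \<le> d" "x0 \<le> d" "f_max f K \<le> d" using K_less_f_max[OF A] by (auto simp: d_def)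
  have "continuous_on {K..d} f"
    using f_continuous[OF A] K_pos[OF A] by (elim continuous_on_subset) auto
  then obtain q where q: "q \<in> {K..d}" "\<And>x. x \<in> {K..d} \<Longrightarrow> f q \<le> f x"
    using continuous_attains_inf[of "{K..d}" f] d by auto
  define c where "c = min x0 (f q)"
  have c: "0 < c" "c \<le> x0" "c \<le> f q"
    using q(1) x0 f_pos[OF A, of q] K_pos[OF A] by (auto simp: c_def)
  have "f x \<in> {c..d}" if x: "x \<in> {c..d}" for x
  proof (cases x K rule: linorder_cases)
    case less
    then show ?thesis using f_above[OF A, of x] f_le_f_max[OF A, of x] x c d by auto
  next
    case equal
    then show ?thesis using x f_at_K[OF A] by simp
  next
    case greater
    then show ?thesis using f_below[OF A, of x] q(2)[of x] x c by auto
  qed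
  with c d that show thesis by auto
qed

lemma G_between:
  assumes "\<beta> \<in> {lo..hi}"
  shows "G f \<beta> x \<in> {min (G f lo x) (G f hi x)..max (G f lo x) (G f hi x)}"
  using assms G_mono[of f x lo \<beta>] G_mono[of f x \<beta> hi] G_antimono[of x f lo \<beta>] G_antimono[of x f \<beta> hi]
  by (cases "f x \<le> x") (auto simp: min_def max_def)

lemma G_in_interval:
  assumes "x \<in> {c..d}" "f x \<in> {c..d}" "\<beta> \<in> {0..1}"
  shows "G f \<beta> x \<in> {c..d}"
  using convexD[OF convex_real_interval(5)[of c d], of "f x" x "1 - \<beta>" \<beta>] assms
  by (simp add: G_def)

lemma controlled_orbits_uniformly_attracted:
  assumes B: "assumption_B f K Lminus Lplus"
    and lo: "beta_lower f K < lo" and "lo \<le> hi" "hi < 1"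
    and x0: "0 < x0" and "0 < \<delta>"
  shows "\<exists>N. \<forall>\<alpha>. (\<forall>n. \<alpha> n \<in> {lo..hi}) \<longrightarrow>
    (\<forall>n\<ge>N. controlled_orbit f \<alpha> x0 n \<in> {K - \<delta><..<K + \<delta>})"
proof -
  have A: "assumption_A f K" using B by (simp add: assumption_B_def)
  obtain \<gamma> where \<gamma>: "\<gamma> \<in> stabilizing_set f K" "\<gamma> < lo"
    using cInf_lessD[OF stabilizing_set_nonempty[OF B]] lo unfolding beta_lower_def by blast
  have "0 < \<gamma>" using \<gamma> by (auto simp: stabilizing_set_def)
  with \<gamma> assms have range: "lo \<in> {\<gamma>..<1}" "hi \<in> {\<gamma>..<1}" "lo \<in> {0..1}" "hi \<in> {0..1}" by auto
  obtain c d where cd: "0 < c" "x0 \<in> {c..d}" "\<And>x. x \<in> {c..d} \<Longrightarrow> f x \<in> {c..d}"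
    by (rule invariant_interval[OF A x0]) blast
  define l where "l x = min (G f lo x) (G f hi x)" for x
  define u where "u x = max (G f lo x) (G f hi x)" for x
  have "continuous_on {c..d} f"
    using f_continuous[OF A] cd(1) by (elim continuous_on_subset) auto
  then have cont: "continuous_on {c..d} l" "continuous_on {c..d} u"
    unfolding l_def u_def by (intro continuous_intros continuous_on_G; assumption)+
  have inv: "c \<le> l x \<and> l x \<le> u x \<and> u x \<le> d" if "x \<in> {c..d}" for x
    using G_in_interval[where f = f, OF that cd(3)[OF that]] range by (auto simp: l_def u_def)
  have "c \<le> d" using cd(2) by simp
  then obtain a b s t where ab:
    "c \<le> a" "s \<in> {a..b}" "t \<in> {a..b}" "l s = a" "u t = b"
    and attract: "\<forall>\<epsilon>>0. \<exists>N. \<forall>x. x 0 \<in> {c..d} \<longrightarrow>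
       (\<forall>n. x (Suc n) \<in> {l (x n)..u (x n)}) \<longrightarrow> (\<forall>n\<ge>N. x n \<in> {a - \<epsilon><..<b + \<epsilon>})"
    by (rule nested_interval_attractor[OF _ cont inv]) blast
  obtain \<sigma> where \<sigma>: "\<sigma> \<in> {lo, hi}" "G f \<sigma> s = a" using ab by (auto simp: l_def min_def split: if_splits)
  obtain \<tau> where \<tau>: "\<tau> \<in> {lo, hi}" "G f \<tau> t = b" using ab by (auto simp: u_def max_def split: if_splits)
  have "a = K \<and> b = K"
    using self_reproducing_interval_trivial[OF A \<gamma>(1), of \<sigma> \<tau> a s b t] \<sigma> \<tau> range ab cd(1) by auto
  with attract \<open>0 < \<delta>\<close> obtain N where N: "\<And>x. x 0 \<in> {c..d} \<Longrightarrow>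
       (\<forall>n. x (Suc n) \<in> {l (x n)..u (x n)}) \<Longrightarrow> (\<forall>n\<ge>N. x n \<in> {K - \<delta><..<K + \<delta>})"
    by blast
  have "\<forall>n\<ge>N. controlled_orbit f \<alpha> x0 n \<in> {K - \<delta><..<K + \<delta>}" if "\<forall>n. \<alpha> n \<in> {lo..hi}" for \<alpha>
  proof (rule N)
    show "\<forall>n. controlled_orbit f \<alpha> x0 (Suc n) \<in>
        {l (controlled_orbit f \<alpha> x0 n)..u (controlled_orbit f \<alpha> x0 n)}"
      using G_between[of _ lo hi f] that unfolding l_def u_def by (simp add: G_def)
  qed (use cd(2) in simp)
  then show ?thesis by blast
qed

text \<open>The uniform statement applied to every neighbourhood of \<open>K\<close> is the pointwise one.\<close>

theorem theorem1:
  fixes f :: "real \<Rightarrow> real" and K Lminus Lplus \<beta>lo \<beta>hi :: real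
  assumes "assumption_B f K Lminus Lplus"
    and "\<beta>lo \<in> {beta_lower f K<..<1}"
    and "\<beta>hi \<in> {\<beta>lo<..<1}"
  shows "(\<forall>\<alpha>. (\<forall>n. \<alpha> n \<in> {\<beta>lo..\<beta>hi}) \<longrightarrow>
            (\<forall>x0>0. controlled_orbit f \<alpha> x0 \<longlonglongrightarrow> K)) \<and>
         (\<forall>x0>0. \<forall>\<delta>>0. \<exists>S1. \<forall>\<alpha>. (\<forall>n. \<alpha> n \<in> {\<beta>lo..\<beta>hi}) \<longrightarrow>
            (\<forall>n\<ge>S1. controlled_orbit f \<alpha> x0 n \<in> {K - \<delta><..<K + \<delta>}))"
proof -
  have unif: "\<exists>S1. \<forall>\<alpha>. (\<forall>n. \<alpha> n \<in> {\<beta>lo..\<beta>hi}) \<longrightarrow>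
      (\<forall>n\<ge>S1. controlled_orbit f \<alpha> x0 n \<in> {K - \<delta><..<K + \<delta>})" if "0 < x0" "0 < \<delta>" for x0 \<delta>
    using controlled_orbits_uniformly_attracted[OF assms(1), of \<beta>lo \<beta>hi x0 \<delta>] assms(2,3) that by auto
  moreover have "controlled_orbit f \<alpha> x0 \<longlonglongrightarrow> K"
    if \<alpha>: "\<forall>n. \<alpha> n \<in> {\<beta>lo..\<beta>hi}" and "0 < x0" for \<alpha> x0
  proof (rule LIMSEQ_I)
    fix r :: real
    assume "0 < r"
    with unif[OF \<open>0 < x0\<close>] \<alpha> obtain N
      where "\<forall>n\<ge>N. controlled_orbit f \<alpha> x0 n \<in> {K - r<..<K + r}" by metis
    then show "\<exists>N. \<forall>n\<ge>N. norm (controlled_orbit f \<alpha> x0 n - K) < r"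
      by (intro exI[of _ N]) (auto simp: abs_less_iff)
  qed
  ultimately show ?thesis by blast
qed

end
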